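(* Given an ensemble model $f_{\text{ens}}$, defined by $f_{\text{ens}}(x)=\frac{1}{M}\sum_{i=1}^{M}f_i(x)$, and a single model $f$ from the model set $\mathcal{F}=\{f_1,\dots,f_M\}$, where $(x,y)$ are drawn from the distribution $\mathcal{D}$, with $x$ and $y$ representing the input and output spaces of the models, respectively. Then $$\mathbb{E}_{(x,y)\sim \mathcal{D};\, f\sim \mathcal{F}}\left[\mathcal{L}(f_{\text{ens}}(x), y)\right] \leq \mathbb{E}_{(x,y)\sim \mathcal{D};\, f\sim \mathcal{F}}\left[\mathcal{L}(f(x), y)\right].$$
   Context: The models are neural networks for object detection, viewed as mappings $f:\mathcal{I}\subseteq\mathbb{R}^{H\times W\times C}\to\mathcal{Y}\subseteq\mathbb{R}^{N}$ from the input space $\mathcal{I}$ to the output space $\mathcal{Y}$; $M$ is the number of models in $\mathcal{F}$. $\mathcal{L}$ is the loss: for a model $f$ there is a model-dependent loss function on $\mathcal{I}\times\mathcal{Y}$ with values in $\mathbb{R}^+$, which is the composition of a differentiable training loss $\mathcal{L}$ (e.g., cross-entropy loss) with the model's confidence score, written $\mathcal{L}(f(x),y)$ for $(x,y)\in\mathcal{I}\times\mathcal{Y}$. The notation $f\sim\mathcal{F}$ means that $f$ is drawn from the model set $\mathcal{F}$; the statement does not specify the law further.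
   Formalization: The loss is assumed convex in the prediction on a convex output space (else false: loss 1/(1+u²), constant models 1 and −1, give 1 > 1/2); f is drawn uniformly from the model set, independently of (x,y); models and loss are measurable. *)

theory Defs
  imports "HOL-Probability.Probability"
begin

text \<open>
  A drawn model is uniform on the finite model set \<open>F\<close> and independent of the data, so the
  joint law of \<open>((x, y), g)\<close> is the product of the data law with
  \<^const>\<open>uniform_count_measure\<close> \<open>F\<close>.  Losses are nonnegative, and expected losses are taken in
  \<open>[0, \<infinity>]\<close> by \<^const>\<open>nn_integral\<close>: no integrability is assumed, and a loss without
  finite mean has expectation \<open>\<infinity>\<close>, not \<open>0\<close> as with the Bochner integral.

  The training loss is taken to be convex in its first argument (the prediction), as the
  cross-entropy loss is.  For a loss that is only differentiable and nonnegative the averaged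
  model can do worse than the average of the models: take \<open>L u y = 1 / (1 + u\<^sup>2)\<close> and the
  constant models \<open>1\<close> and \<open>-1\<close>, where the losses are \<open>1\<close> and \<open>1/2\<close>.
  Convexity of the output space, which is part of \<^const>\<open>convex_on\<close>, makes the averaged model
  take values in it.
\<close>

definition ensemble :: "nat \<Rightarrow> (nat \<Rightarrow> 'x \<Rightarrow> 'y::real_vector) \<Rightarrow> 'x \<Rightarrow> 'y" where
  "ensemble M f x = (1 / real M) *\<^sub>R (\<Sum>i=1..M. f i x)"

end

theory Submission
  imports Defs
begin

text \<open>
  Integrating out the model first turns the right-hand side into the data expectation of the
  average loss \<open>(\<Sum>i. L (f\<^sub>i x) y) / M\<close>, and the left-hand side into the data expectation of
  \<open>L (\<Sum>i. f\<^sub>i x / M) y\<close>; convexity of the loss in the prediction (Jensen's inequality for a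
  finite convex combination) compares the integrands pointwise.
\<close>

text \<open>Tonelli, with the model as inner variable: under a point measure on a finite set the
  inner integral is a weighted sum. Both sides of the theorem are brought to this form.\<close>

lemma nn_integral_pair_uniform_count_measure:
  fixes h :: "'a \<Rightarrow> 'b \<Rightarrow> ennreal"
  assumes "finite F" "F \<noteq> {}"
    and [measurable]: "\<And>g. g \<in> F \<Longrightarrow> (\<lambda>z. h z g) \<in> borel_measurable D"
  shows "(\<integral>\<^sup>+ (z, g). h z g \<partial>(D \<Otimes>\<^sub>M uniform_count_measure F))
       = (\<integral>\<^sup>+ z. (\<Sum>g\<in>F. ennreal (1 / card F) * h z g) \<partial>D)"
proof -
  interpret F: prob_space "uniform_count_measure F"
    using assms by (intro prob_space_uniform_count_measure)
  \<comment> \<open>Joint measurability follows from measurability in \<open>z\<close> for each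
    fixed \<open>g\<close>, because \<open>g\<close> ranges over a countable discrete space.\<close>
  have "(\<lambda>p. h (fst p) (snd p)) \<in> borel_measurable (D \<Otimes>\<^sub>M count_space F)"
    by (rule measurable_compose_countable'[where f = "\<lambda>g p. h (fst p) g" and g = snd and I = F])
      (use assms in \<open>auto intro: countable_finite\<close>)
  then have "(\<lambda>(z, g). h z g) \<in> borel_measurable (D \<Otimes>\<^sub>M uniform_count_measure F)"
    by (simp add: case_prod_beta cong: measurable_cong_sets sets_pair_measure_cong)
  then have "(\<integral>\<^sup>+ (z, g). h z g \<partial>(D \<Otimes>\<^sub>M uniform_count_measure F))
      = (\<integral>\<^sup>+ z. \<integral>\<^sup>+ g. h z g \<partial>uniform_count_measure F \<partial>D)"
    by (simp add: F.nn_integral_fst[symmetric])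
  also have "\<dots> = (\<integral>\<^sup>+ z. (\<Sum>g\<in>F. ennreal (1 / card F) * h z g) \<partial>D)"
    unfolding uniform_count_measure_def
    by (simp only: nn_integral_point_measure_finite[OF \<open>finite F\<close>])
  finally show ?thesis .
qed

text \<open>With the scalar moved inside the sum, the ensemble is a combination with weights
  \<open>1 / M\<close>; these sum to 1 because \<open>M \<ge> 1\<close>.\<close>

lemma ensemble_in_convex:
  assumes "convex Y" "M \<ge> 1" "\<And>i. i \<in> {1..M} \<Longrightarrow> f i x \<in> Y"
  shows "ensemble M f x \<in> Y"
  unfolding ensemble_def scaleR_sum_right
  using assms by (intro convex_sum) auto

lemma convex_on_ensemble_le:
  assumes "convex_on Y \<phi>" "M \<ge> 1" "\<And>i. i \<in> {1..M} \<Longrightarrow> f i x \<in> Y"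
  shows "\<phi> (ensemble M f x) \<le> (\<Sum>i=1..M. 1 / real M * \<phi> (f i x))"
  unfolding ensemble_def scaleR_sum_right
  using assms by (intro convex_on_sum) auto

text \<open>The loss is measurable only over \<open>Y\<close>, so the ensemble must be measurable
  into the restricted space; convexity of \<open>Y\<close> keeps its values there.\<close>

lemma measurable_ensemble:
  fixes f :: "nat \<Rightarrow> 'x \<Rightarrow> 'y::{second_countable_topology, real_normed_vector}"
  assumes "convex Y" "M \<ge> 1"
    and f: "\<And>i. i \<in> {1..M} \<Longrightarrow> f i \<in> N \<rightarrow>\<^sub>M restrict_space borel Y"
  shows "ensemble M f \<in> N \<rightarrow>\<^sub>M restrict_space borel Y"
proof (rule measurable_restrict_space2)
  have "f i x \<in> Y" if "i \<in> {1..M}" "x \<in> space N" for i x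
    using measurable_space[OF f] that by (simp add: space_restrict_space)
  then show "ensemble M f \<in> space N \<rightarrow> Y"
    using assms by (auto intro: ensemble_in_convex)
  have [measurable]: "f i \<in> borel_measurable N" if "i \<in> {1..M}" for i
    using f[OF that] by (simp add: measurable_restrict_space2_iff)
  show "ensemble M f \<in> borel_measurable N"
    unfolding ensemble_def[abs_def] by measurable
qed

theorem theorem1:
  fixes I :: "(real ^ 'c ^ 'w ^ 'h) set"
    and Y :: "(real ^ 'n) set"
    and D :: "((real ^ 'c ^ 'w ^ 'h) \<times> (real ^ 'n)) measure"
    and L :: "real ^ 'n \<Rightarrow> real ^ 'n \<Rightarrow> real"
    and f :: "nat \<Rightarrow> real ^ 'c ^ 'w ^ 'h \<Rightarrow> real ^ 'n"
    and F :: "(real ^ 'c ^ 'w ^ 'h \<Rightarrow> real ^ 'n) set"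
    and M :: nat
  assumes "M \<ge> 1"
    and "F = f ` {1..M}" and "card F = M"
    and "\<And>i. i \<in> {1..M} \<Longrightarrow> f i \<in> restrict_space borel I \<rightarrow>\<^sub>M restrict_space borel Y"
    and "prob_space D"
    and "sets D = sets (restrict_space borel I \<Otimes>\<^sub>M restrict_space borel Y)"
    and "\<And>u y. u \<in> Y \<Longrightarrow> y \<in> Y \<Longrightarrow> L u y \<ge> 0"
    and "(\<lambda>(u, y). L u y) \<in> borel_measurable (restrict_space borel Y \<Otimes>\<^sub>M restrict_space borel Y)"
    and "\<And>y. y \<in> Y \<Longrightarrow> (\<lambda>u. L u y) differentiable_on Y"
    and "\<And>y. y \<in> Y \<Longrightarrow> convex_on Y (\<lambda>u. L u y)"
  shows "(\<integral>\<^sup>+ ((x, y), g). ennreal (L (ensemble M f x) y) \<partial>(D \<Otimes>\<^sub>M uniform_count_measure F))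
       \<le> (\<integral>\<^sup>+ ((x, y), g). ennreal (L (g x) y) \<partial>(D \<Otimes>\<^sub>M uniform_count_measure F))"
proof -
  let ?X = "restrict_space borel I :: (real ^ 'c ^ 'w ^ 'h) measure"
  let ?Y = "restrict_space borel Y :: (real ^ 'n) measure"
  note f = assms(4) and sets_D = assms(6)
  have F: "finite F" "F \<noteq> {}"
    using assms(1,2) by auto
  \<comment> \<open>\<open>card F = M\<close> says that the models are distinct, so the uniform law
    on the set \<open>F\<close> gives each index weight \<open>1 / M\<close>. This allows sums over
    \<open>F\<close> to be reindexed by \<open>{1..M}\<close>.\<close>
  have inj: "inj_on f {1..M}"
    using assms(2,3) by (intro eq_card_imp_inj_on) auto
  have "space D = I \<times> Y"
    using sets_eq_imp_space_eq[OF sets_D] by (simp add: space_pair_measure space_restrict_space)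
  then have D: "x \<in> I" "y \<in> Y" if "(x, y) \<in> space D" for x y
    using that by auto
  have fY: "f i x \<in> Y" if "i \<in> {1..M}" "x \<in> I" for i x
    using measurable_space[OF f[OF that(1)], of x] that by (simp add: space_restrict_space)
  interpret D: prob_space D by fact
  \<comment> \<open>Convexity of \<open>Y\<close> is contained in \<open>convex_on\<close>, which is
    assumed only for labels in \<open>Y\<close>; a probability space is nonempty and so supplies
    such a label.\<close>
  obtain x0 y0 where "(x0, y0) \<in> space D"
    using D.not_empty by fastforce
  then have "convex Y"
    using D assms(10) by (blast intro: convex_on_imp_convex)
  \<comment> \<open>The loss of \<open>g\<close> is \<open>L\<close> composed with the map from
    \<open>(x, y)\<close> to \<open>(g x, y)\<close>.\<close>
  have loss: "(\<lambda>(x, y). ennreal (L (g x) y)) \<in> borel_measurable D" if g: "g \<in> ?X \<rightarrow>\<^sub>M ?Y" for g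
  proof -
    have "(\<lambda>p. (g (fst p), snd p)) \<in> ?X \<Otimes>\<^sub>M ?Y \<rightarrow>\<^sub>M ?Y \<Otimes>\<^sub>M ?Y"
      using g by measurable
    from measurable_compose[OF this assms(8)]
    have "(\<lambda>p. L (g (fst p)) (snd p)) \<in> borel_measurable D"
      by (simp add: measurable_cong_sets[OF sets_D refl])
    from measurable_compose[OF this measurable_ennreal] show ?thesis
      by (simp add: case_prod_beta')
  qed
  \<comment> \<open>Both integrands are written as functions of the data point and the model, the
    shape that the Tonelli lemma expects.\<close>
  let ?ens = "\<lambda>(x, y) g. ennreal (L (ensemble M f x) y)"
  let ?single = "\<lambda>(x, y) g. ennreal (L (g x) y)"
  have "(\<integral>\<^sup>+ ((x, y), g). ennreal (L (ensemble M f x) y) \<partial>(D \<Otimes>\<^sub>M uniform_count_measure F))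
      = (\<integral>\<^sup>+ z. (\<Sum>g\<in>F. ennreal (1 / card F) * ?ens z g) \<partial>D)"
    using loss[OF measurable_ensemble[OF \<open>convex Y\<close> assms(1) f]]
    by (intro nn_integral_pair_uniform_count_measure[OF F]) (simp add: case_prod_beta')
  also have "\<dots> \<le> (\<integral>\<^sup>+ z. (\<Sum>g\<in>F. ennreal (1 / card F) * ?single z g) \<partial>D)"
  proof (rule nn_integral_mono, clarsimp simp del: sum_constant)
    fix x y assume "(x, y) \<in> space D"
    note xy = D[OF this]
    \<comment> \<open>The ensemble loss is constant in \<open>g\<close>, so its \<open>M\<close>
      copies of weight \<open>1 / M\<close> add up to it.\<close>
    have "(\<Sum>g\<in>F. ennreal (1 / card F) * ennreal (L (ensemble M f x) y)) = ennreal (L (ensemble M f x) y)"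
      using assms(1,3) xy fY assms(7) ensemble_in_convex[OF \<open>convex Y\<close> assms(1), of f x]
      by (simp add: ennreal_of_nat_eq_real_of_nat ennreal_mult[symmetric])
    also have "\<dots> \<le> ennreal (\<Sum>i=1..M. 1 / real M * L (f i x) y)"
      using assms(1,10) xy fY by (intro ennreal_leI convex_on_ensemble_le) auto
    \<comment> \<open>Nonnegativity of the losses lets \<open>ennreal\<close> pass through the sum
      and the products.\<close>
    also have "\<dots> = (\<Sum>i=1..M. ennreal (1 / card F) * ennreal (L (f i x) y))"
      using assms(3,7) xy fY by (subst sum_ennreal[symmetric]) (auto simp: ennreal_mult[symmetric])
    also have "\<dots> = (\<Sum>g\<in>F. ennreal (1 / card F) * ennreal (L (g x) y))"
      unfolding assms(2) sum.reindex[OF inj] comp_def ..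
    finally show "(\<Sum>g\<in>F. ennreal (1 / card F) * ennreal (L (ensemble M f x) y))
        \<le> (\<Sum>g\<in>F. ennreal (1 / card F) * ennreal (L (g x) y))" .
  qed
  also have "\<dots> = (\<integral>\<^sup>+ ((x, y), g). ennreal (L (g x) y) \<partial>(D \<Otimes>\<^sub>M uniform_count_measure F))"
    using loss f assms(2)
    by (intro nn_integral_pair_uniform_count_measure[OF F, symmetric]) (auto simp: case_prod_beta')
  finally show ?thesis .
qed

end
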